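(* Let $m\ge1$ be an integer, $\delta_0,\delta_1\in(-m,+\infty)$ with $\delta_0\ne\delta_1$, and let $(\tau_n)_{n\ge1}$ be integers with $1\le\tau_n\le n$ and $\Delta_n=n-\tau_n$. Let $Q_0^n=\mathbb P_0^n(G_n\in\cdot)$ and $Q_1^n=\mathbb P_1^n(G_n\in\cdot)$. (1) If $\tau_n\to\infty$ and $\Delta_n\to\infty$, then the likelihood-ratio test $T_n=\mathbf 1\big(\frac{\mathrm dQ_1^n}{\mathrm dQ_0^n}(G_n)>1\big)$ satisfies $\mathbb E_0^n(T_n)+\mathbb E_1^n(1-T_n)\to0$. (2) If $\limsup_{n\to\infty}\Delta_n<+\infty$, then $(Q_1^n)_{n\ge1}$ is contiguous with respect to $(Q_0^n)_{n\ge1}$, i.e. for every sequence of measurable sets $(E_n)$, $Q_0^n(E_n)\to0$ implies $Q_1^n(E_n)\to0$.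
   Context: A labeled graph $\mathfrak g$ is a finite directed multigraph without loops; the degree $\mathrm d_{\mathfrak g}(v)$ is the in-degree plus the out-degree of $v$, counted with multiplicity. Preferential attachment with parameter function $\delta:\mathbb N\to(-m,+\infty)$: $G_{1,0}$ consists of two isolated vertices $0,1$; for $i=1,\dots,m$, $G_{1,i}$ is obtained from $G_{1,i-1}$ by adding an edge directed from $1$ to $0$. For $t\ge2$, $G_{t,0}$ is $G_{t-1,m}$ together with an isolated vertex $t$; for $i=1,\dots,m$, $G_{t,i}$ is obtained from $G_{t,i-1}$ by adding an edge directed from $t$ to a random vertex $V_{t,i}\in\{0,\dots,t-1\}$ where, conditionally on the past, $V_{t,i}=v$ with probability $$\frac{\mathrm d_{G_{t,i-1}}(v)+\delta(t)}{2m(t-1)+\delta(t)t+(i-1)}.$$ Set $G_t=G_{t,m}$, a labeled graph on $\{0,\dots,t\}$ (the order of arrival of the $m$ edges added at each time is forgotten). For each $n$, $\mathbb P_0^n$ (expectation $\mathbb E_0^n$) is the probability under which the process up to time $n$ is generated with $\delta(t)=\delta_0$ for all $t$, and $\mathbb P_1^n$ (expectation $\mathbb E_1^n$) the probability under which it is generated with $\delta(t)=\delta_0\mathbf 1_{t\le\tau_n}+\delta_1\mathbf 1_{t>\tau_n}$. The laws $Q_0^n$ and $Q_1^n$ have the same finite support. *)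

theory Defs
  imports "HOL-Probability.Probability"
begin

text \<open>
  A labeled graph is stored as its vertex set together with the multiset of its arcs
  (tail, head).  A multiset keeps the multiplicities and forgets the order in which the arcs
  were added.
\<close>

datatype lgraph = LGraph (verts: "nat set") (arcs: "(nat \<times> nat) multiset")

definition labeled_graph :: "lgraph \<Rightarrow> bool" where
  "labeled_graph g \<longleftrightarrow> finite (verts g) \<and>
     (\<forall>(u, v) \<in># arcs g. u \<in> verts g \<and> v \<in> verts g \<and> u \<noteq> v)"

definition degree :: "lgraph \<Rightarrow> nat \<Rightarrow> nat" where
  "degree g v = size {#e \<in># arcs g. snd e = v#} + size {#e \<in># arcs g. fst e = v#}"

definition add_vertex :: "nat \<Rightarrow> lgraph \<Rightarrow> lgraph" where
  "add_vertex u g = LGraph (insert u (verts g)) (arcs g)"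

definition add_arc :: "nat \<Rightarrow> nat \<Rightarrow> lgraph \<Rightarrow> lgraph" where
  "add_arc u v g = LGraph (verts g) (add_mset (u, v) (arcs g))"

text \<open>
  The law of \<open>V\<^sub>t\<^sub>,\<^sub>i\<close> given that \<open>G\<^sub>t\<^sub>,\<^sub>i\<^sub>-\<^sub>1 = g\<close>; the argument \<open>d\<close> is \<open>\<delta>(t)\<close>.  On the graphs that
  the process can reach, the weights below are nonnegative and sum to 1, so that \<open>embed_pmf\<close>
  does not return a junk value: see \<open>pmf_attach_pmf\<close> and \<open>pa_arcs_valid\<close>.
\<close>

definition attach_pmf :: "nat \<Rightarrow> real \<Rightarrow> nat \<Rightarrow> nat \<Rightarrow> lgraph \<Rightarrow> nat pmf" where
  "attach_pmf m d t i g = embed_pmf (\<lambda>v. if v < t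
     then (real (degree g v) + d) / (2 * real m * (real t - 1) + d * real t + (real i - 1))
     else 0)"

text \<open>
  A trajectory \<open>G\<close> assigns to \<open>(t, i)\<close> the graph \<open>G\<^sub>t\<^sub>,\<^sub>i\<close>.  The process up to time \<open>n\<close> fills in the
  entries with \<open>1 \<le> t \<le> n\<close> and \<open>i \<le> m\<close>; the other entries are \<open>undefined\<close>.
\<close>

type_synonym trajectory = "nat \<times> nat \<Rightarrow> lgraph"

definition initial_trajectory :: "nat \<Rightarrow> trajectory" where
  "initial_trajectory m = (\<lambda>(t, i).
     if t = 1 \<and> i \<le> m then LGraph {0, 1} (replicate_mset i (1, 0)) else undefined)"

primrec pa_arcs :: "nat \<Rightarrow> (nat \<Rightarrow> real) \<Rightarrow> nat \<Rightarrow> nat \<Rightarrow> trajectory \<Rightarrow> trajectory pmf" where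
  "pa_arcs m \<delta> t 0 G = return_pmf (G((t, 0) := add_vertex t (G (t - 1, m))))"
| "pa_arcs m \<delta> t (Suc i) G =
     bind_pmf (pa_arcs m \<delta> t i G) (\<lambda>H.
     bind_pmf (attach_pmf m (\<delta> t) t (Suc i) (H (t, i))) (\<lambda>v.
     return_pmf (H((t, Suc i) := add_arc t v (H (t, i))))))"

text \<open>The process starts at time 1; the value at time 0 is a dummy.\<close>

fun pa_process :: "nat \<Rightarrow> (nat \<Rightarrow> real) \<Rightarrow> nat \<Rightarrow> trajectory pmf" where
  "pa_process m \<delta> 0 = return_pmf (\<lambda>_. undefined)"
| "pa_process m \<delta> (Suc 0) = return_pmf (initial_trajectory m)"
| "pa_process m \<delta> (Suc (Suc n)) =
     bind_pmf (pa_process m \<delta> (Suc n)) (\<lambda>G. pa_arcs m \<delta> (Suc (Suc n)) m G)"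

definition graph_at :: "nat \<Rightarrow> nat \<Rightarrow> trajectory \<Rightarrow> lgraph" where
  "graph_at m t G = G (t, m)"

definition P0 :: "nat \<Rightarrow> real \<Rightarrow> nat \<Rightarrow> trajectory pmf" where
  "P0 m \<delta>0 n = pa_process m (\<lambda>_. \<delta>0) n"

definition P1 :: "nat \<Rightarrow> real \<Rightarrow> real \<Rightarrow> (nat \<Rightarrow> nat) \<Rightarrow> nat \<Rightarrow> trajectory pmf" where
  "P1 m \<delta>0 \<delta>1 \<tau> n = pa_process m (\<lambda>t. if t \<le> \<tau> n then \<delta>0 else \<delta>1) n"

definition Q0 :: "nat \<Rightarrow> real \<Rightarrow> nat \<Rightarrow> lgraph pmf" where
  "Q0 m \<delta>0 n = map_pmf (graph_at m n) (P0 m \<delta>0 n)"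

definition Q1 :: "nat \<Rightarrow> real \<Rightarrow> real \<Rightarrow> (nat \<Rightarrow> nat) \<Rightarrow> nat \<Rightarrow> lgraph pmf" where
  "Q1 m \<delta>0 \<delta>1 \<tau> n = map_pmf (graph_at m n) (P1 m \<delta>0 \<delta>1 \<tau> n)"

text \<open>\<open>RN_deriv M N\<close> is the derivative of \<open>N\<close> with respect to \<open>M\<close>, so that this is
  the indicator of \<open>dQ/dP > 1\<close>.\<close>

definition lr_test :: "'a measure \<Rightarrow> 'a measure \<Rightarrow> 'a \<Rightarrow> real" where
  "lr_test P Q g = of_bool (RN_deriv P Q g > 1)"

text \<open>Contiguity of \<open>(Q n)\<close> with respect to \<open>(P n)\<close>, sequences indexed by \<open>n \<ge> 1\<close>,
  with \<open>P n\<close> and \<open>Q n\<close> on the same measurable space.\<close>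

definition contiguous :: "(nat \<Rightarrow> 'a measure) \<Rightarrow> (nat \<Rightarrow> 'a measure) \<Rightarrow> bool" where
  "contiguous Q P \<longleftrightarrow>
     (\<forall>E. (\<forall>n\<ge>1. E n \<in> sets (P n)) \<longrightarrow> (\<lambda>n. measure (P n) (E n)) \<longlonglongrightarrow> 0 \<longrightarrow>
        (\<lambda>n. measure (Q n) (E n)) \<longlonglongrightarrow> 0)"


subsection \<open>Well-definedness of the process\<close>

definition pa_valid :: "nat \<Rightarrow> nat \<Rightarrow> nat \<Rightarrow> lgraph \<Rightarrow> bool" where
  "pa_valid m t i g \<longleftrightarrow> verts g = {0..t} \<and> (\<forall>(u, v) \<in># arcs g. v < u \<and> u \<le> t) \<and>
     size (arcs g) = m * (t - 1) + i \<and> degree g t = i \<and> (\<forall>v<t. m \<le> degree g v)"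

lemma pa_valid_labeled_graph: "pa_valid m t i g \<Longrightarrow> labeled_graph g"
  unfolding pa_valid_def labeled_graph_def by fastforce

lemma sum_size_filter:
  assumes "finite V" "\<forall>e \<in># A. f e \<in> V"
  shows "(\<Sum>v\<in>V. size {#e \<in># A. f e = v#}) = size A"
  using assms(2)
proof (induction A)
  case (add x A)
  have *: "size {#e \<in># add_mset x A. f e = v#} = size {#e \<in># A. f e = v#} + (if f x = v then 1 else 0)"
    for v by simp
  show ?case unfolding * sum.distrib using add assms(1) by simp
qed simp

lemma sum_degree:
  assumes "labeled_graph g"
  shows "(\<Sum>v\<in>verts g. degree g v) = 2 * size (arcs g)"
  unfolding degree_def sum.distrib
  using assms by (subst (1 2) sum_size_filter) (auto simp: labeled_graph_def)

lemma attach_denominator_pos: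
  assumes "d > - real m" "2 \<le> t"
  shows "0 < 2 * real m * (real t - 1) + d * real t + real i"
proof -
  have "real m * real t \<ge> real m * 2"
    using assms(2) by (intro mult_left_mono) auto
  moreover have "- real m * real t < d * real t"
    using assms by (intro mult_strict_right_mono) auto
  moreover have "2 * real m * (real t - 1) + d * real t + real i =
      (d * real t - (- real m * real t)) + (real m * real t - real m * 2) + real i"
    by (simp add: algebra_simps)
  ultimately show ?thesis by linarith
qed

lemma pmf_attach_pmf:
  assumes "pa_valid m t i g" "d > - real m" "2 \<le> t"
  shows "pmf (attach_pmf m d t (Suc i) g) v = (if v < t
     then (real (degree g v) + d) / (2 * real m * (real t - 1) + d * real t + (real (Suc i) - 1))
     else 0)"
proof -
  define D where "D = 2 * real m * (real t - 1) + d * real t + (real (Suc i) - 1)"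
  define f where "f v = (if v < t then (real (degree g v) + d) / D else 0)" for v
  have D: "0 < D"
    using attach_denominator_pos[OF assms(2,3), of i] by (simp add: D_def)
  have deg: "degree g v \<ge> m" if "v < t" for v
    using that assms by (auto simp: pa_valid_def)
  have nonneg: "0 \<le> f v" for v
  proof (cases "v < t")
    case True
    have "real m \<le> real (degree g v)" using deg[OF True] by simp
    then have "0 \<le> real (degree g v) + d" using assms(2) by linarith
    then show ?thesis using D by (simp add: f_def)
  qed (simp add: f_def)
  have vs: "verts g = insert t {..<t}"
    using assms(1) by (auto simp: pa_valid_def)
  have "(\<Sum>v\<in>verts g. degree g v) = 2 * (m * (t - 1) + i)"
    using sum_degree[OF pa_valid_labeled_graph[OF assms(1)]] assms(1)
    by (simp add: pa_valid_def)
  then have "i + (\<Sum>v<t. degree g v) = 2 * (m * (t - 1) + i)"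
    unfolding vs using assms(1) by (simp add: pa_valid_def)
  then have "real i + (\<Sum>v<t. real (degree g v)) = 2 * (real m * real (t - 1) + real i)"
    unfolding of_nat_sum[symmetric] of_nat_add[symmetric] of_nat_mult[symmetric] by linarith
  then have "(\<Sum>v<t. real (degree g v) + d) = D"
    using assms(3) by (simp add: sum.distrib D_def of_nat_diff algebra_simps)
  then have "(\<Sum>v<t. f v) = 1"
    using D by (simp add: f_def flip: sum_divide_distrib)
  moreover have "(\<integral>\<^sup>+v. ennreal (f v) \<partial>count_space UNIV) = (\<Sum>v<t. ennreal (f v))"
    by (rule nn_integral_count_space') (auto simp: f_def)
  ultimately have "(\<integral>\<^sup>+v. ennreal (f v) \<partial>count_space UNIV) = 1"
    using nonneg by (simp add: sum_ennreal)
  then have "pmf (embed_pmf f) v = f v"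
    using nonneg by (rule pmf_embed_pmf[rotated])
  moreover have "attach_pmf m d t (Suc i) g = embed_pmf f"
    unfolding attach_pmf_def f_def D_def ..
  ultimately show ?thesis by (simp add: f_def D_def)
qed

lemma degree_add_vertex [simp]: "degree (add_vertex u g) v = degree g v"
  by (simp add: degree_def add_vertex_def)

lemma degree_add_arc:
  "degree (add_arc u w g) v = degree g v + (if w = v then 1 else 0) + (if u = v then 1 else 0)"
  by (simp add: degree_def add_arc_def)

lemma pa_valid_add_arc:
  assumes "pa_valid m t i g" "v < t"
  shows "pa_valid m t (Suc i) (add_arc t v g)"
  using assms unfolding pa_valid_def degree_add_arc
  by (auto simp: add_arc_def le_SucI)

lemma pa_valid_add_vertex:
  assumes "pa_valid m t m g" "1 \<le> t"
  shows "pa_valid m (Suc t) 0 (add_vertex (Suc t) g)"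
proof -
  have le: "fst e \<le> t \<and> snd e \<le> t" if "e \<in># arcs g" for e
    using that assms(1) by (fastforce simp: pa_valid_def)
  have "set_mset {#e \<in># arcs g. snd e = Suc t#} = {}"
    "set_mset {#e \<in># arcs g. fst e = Suc t#} = {}"
    using le by fastforce+
  then have "degree g (Suc t) = 0"
    unfolding set_mset_eq_empty_iff degree_def by simp
  moreover have "m \<le> degree g v" if "v < Suc t" for v
    using that assms(1) by (cases "v = t") (auto simp: pa_valid_def)
  moreover have "m * (t - 1) + m = m * t"
    using assms(2) by (cases t) auto
  ultimately show ?thesis
    using assms(1) unfolding pa_valid_def degree_add_vertex
    by (auto simp: add_vertex_def atLeast0_atMost_Suc)
qed

lemma pa_arcs_valid:
  assumes "\<delta> (Suc t) > - real m" "1 \<le> t" "pa_valid m t m (G (t, m))"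
    and "H \<in> set_pmf (pa_arcs m \<delta> (Suc t) i G)"
  shows "pa_valid m (Suc t) i (H (Suc t, i))"
  using assms(4)
proof (induction i arbitrary: H)
  case 0
  then show ?case using pa_valid_add_vertex[OF assms(3,2)] by simp
next
  case (Suc i)
  then obtain K v where K: "K \<in> set_pmf (pa_arcs m \<delta> (Suc t) i G)"
    and v: "v \<in> set_pmf (attach_pmf m (\<delta> (Suc t)) (Suc t) (Suc i) (K (Suc t, i)))"
    and H: "H = K((Suc t, Suc i) := add_arc (Suc t) v (K (Suc t, i)))"
    by auto
  note val = Suc.IH[OF K]
  have "v < Suc t"
    using v pmf_attach_pmf[OF val assms(1), of v] assms(2)
    by (auto simp: set_pmf_iff split: if_splits)
  then show ?case using pa_valid_add_arc[OF val] H by simp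
qed

lemma pa_process_valid:
  assumes "\<And>t. \<delta> t > - real m" "1 \<le> n" "G \<in> set_pmf (pa_process m \<delta> n)"
  shows "pa_valid m n m (graph_at m n G)"
  using assms(2,3)
proof (induction n arbitrary: G rule: nat_induct_at_least)
  case base
  have "size {#e \<in># replicate_mset m x. p e#} = (if p x then m else 0)"
    for p and x :: "nat \<times> nat"
    by (induction m) auto
  with base show ?case
    by (auto simp: pa_valid_def degree_def graph_at_def initial_trajectory_def split: if_splits)
next
  case (Suc n)
  obtain k where k: "n = Suc k" using Suc.hyps by (cases n) auto
  from Suc.prems obtain K where "K \<in> set_pmf (pa_process m \<delta> n)"
    "G \<in> set_pmf (pa_arcs m \<delta> (Suc n) m K)"
    unfolding k by auto
  then show ?case
    using pa_arcs_valid[of m \<delta> n K G m] assms(1) Suc.hyps Suc.IH[of K]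
    unfolding graph_at_def by blast
qed

end

theory Submission
  imports Defs
begin

text \<open>
  The labels reveal the whole history: deleting the youngest vertex from \<open>G\<^sub>n\<close> gives back
  \<open>G\<^sub>n\<^sub>-\<^sub>1\<close>.  Hence the law of \<open>G\<^sub>n\<close> is that of a path of a Markov chain, and both claims are
  about the accumulated likelihood ratio of the steps after the change.

  \<^emph>\<open>Detection.\<close>  The error sum of the likelihood-ratio test is \<open>\<Sum> min Q\<^sub>0 Q\<^sub>1\<close>, at most the
  Bhattacharyya affinity \<open>\<Sum> \<surd>(Q\<^sub>0 Q\<^sub>1)\<close> (\<open>lr_test_error_le_affinity\<close>).  Since the past is
  recoverable, the affinity is multiplied at each step by an average of the affinities of the
  two transition kernels, where a set of exceptional states costs only the square root of its
  \<open>Q\<^sub>0\<close>-probability (\<open>affinity_bind_le\<close>).  So a uniform loss at each step outside rare states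
  suffices, and rarity needs to be checked only for the chain without a change.

  The loss comes from the number of arcs that the new vertex sends to the \<open>a = u div k\<close> youngest
  vertices of \<open>G\<^sub>u\<close>.  Within one step the weight of a vertex set is a Polya urn, so the mean of
  this number is explicit (\<open>expectation_vol_attach_all\<close>); it depends on the parameter as soon as
  the average degree of these vertices differs from the overall average \<open>2m\<close>.  It does:
  young vertices have on average little more than their \<open>m\<close> outgoing arcs, because a first-moment
  bound shows that few of these arcs end among them (\<open>prob_recent_vol_large_le\<close>, with
  exceptional probability at most \<open>4/k\<close>).  Hence the affinity after \<open>\<Delta>\<close> steps is at most
  \<open>(1 - c\<^sub>k)\<^sup>\<Delta> + \<surd>(4/k)\<close> with \<open>c\<^sub>k > 0\<close> (\<open>affinity_graph_law_le\<close>).  Let \<open>\<Delta> \<rightarrow> \<infinity>\<close> and then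
  \<open>k \<rightarrow> \<infinity>\<close>; that \<open>\<tau> \<rightarrow> \<infinity>\<close> ensures \<open>\<tau> \<ge> k\<close>, so that the young vertices are present.

  \<^emph>\<open>Contiguity.\<close>  All degrees are at least \<open>m\<close>, which bounds the likelihood ratio of a
  single arc by a constant \<open>C\<close>.  Thus \<open>Q\<^sub>1 \<le> C\<^sup>m\<^sup>\<Delta> Q\<^sub>0\<close> (\<open>pmf_graph_law_le\<close>), and this is a uniform
  bound when \<open>\<Delta>\<close> is bounded.
\<close>

section \<open>Affinity and domination of finitely supported laws\<close>

text \<open>
  The Bhattacharyya coefficient of laws with finite support.  For these it is symmetric, because
  the summand vanishes outside the support of either law.
\<close>

definition affinity :: "'a pmf \<Rightarrow> 'a pmf \<Rightarrow> real" where
  "affinity p q = (\<Sum>x\<in>set_pmf p. sqrt (pmf p x * pmf q x))"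

lemma affinity_eq_sum:
  assumes "finite S" "set_pmf p \<subseteq> S"
  shows "affinity p q = (\<Sum>x\<in>S. sqrt (pmf p x * pmf q x))"
  unfolding affinity_def
  by (rule sum.mono_neutral_left) (use assms in \<open>auto simp: set_pmf_iff\<close>)

lemma sum_pmf_le_1: "finite S \<Longrightarrow> (\<Sum>x\<in>S. pmf p x) \<le> 1"
  using measure_pmf.prob_le_1[of p S] by (simp add: measure_measure_pmf_finite)

lemma expectation_eq_sum:
  fixes f :: "'a \<Rightarrow> real"
  assumes "finite S" "set_pmf p \<subseteq> S"
  shows "measure_pmf.expectation p f = (\<Sum>x\<in>S. pmf p x * f x)"
  using assms by (subst integral_measure_pmf[of S]) auto

lemma expectation_bind_finite:
  fixes p :: "'a pmf" and K :: "'a \<Rightarrow> 'b pmf" and f :: "'b \<Rightarrow> real"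
  assumes "finite (set_pmf p)" "\<And>x. x \<in> set_pmf p \<Longrightarrow> finite (set_pmf (K x))"
  shows "measure_pmf.expectation (bind_pmf p K) f =
    measure_pmf.expectation p (\<lambda>x. measure_pmf.expectation (K x) f)"
  using pmf_expectation_bind[OF assms order_refl, where h = f] expectation_eq_sum[OF assms(1) order_refl]
  by simp

lemma sum_sqrt_pmf_le:
  assumes "finite S"
  shows "(\<Sum>x\<in>S. sqrt (pmf p x * pmf q x)) \<le> sqrt (measure p S)"
proof (rule real_le_rsqrt)
  have "(\<Sum>x\<in>S. sqrt (pmf p x * pmf q x))\<^sup>2 = (\<Sum>x\<in>S. sqrt (pmf p x) * sqrt (pmf q x))\<^sup>2"
    by (simp add: real_sqrt_mult)
  also have "\<dots> \<le> (\<Sum>x\<in>S. (sqrt (pmf p x))\<^sup>2) * (\<Sum>x\<in>S. (sqrt (pmf q x))\<^sup>2)"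
    by (rule Cauchy_Schwarz_ineq_sum)
  also have "\<dots> = (\<Sum>x\<in>S. pmf p x) * (\<Sum>x\<in>S. pmf q x)"
    by simp
  also have "\<dots> \<le> (\<Sum>x\<in>S. pmf p x) * 1"
    using assms by (intro mult_left_mono sum_pmf_le_1 sum_nonneg) auto
  finally show "(\<Sum>x\<in>S. sqrt (pmf p x * pmf q x))\<^sup>2 \<le> measure p S"
    using assms by (simp add: measure_measure_pmf_finite)
qed

lemma affinity_le_1:
  assumes "finite (set_pmf p)"
  shows "affinity p q \<le> 1"
proof -
  have "affinity p q \<le> sqrt (measure p (set_pmf p))"
    unfolding affinity_def using assms by (rule sum_sqrt_pmf_le)
  also have "\<dots> \<le> 1" using measure_pmf.prob_le_1 by simp
  finally show ?thesis .
qed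

text \<open>
  If the means of a bounded function differ, the laws are apart in Hellinger distance: write
  \<open>p - q = (\<surd>p - \<surd>q)(\<surd>p + \<surd>q)\<close> in the difference of the means and apply Cauchy-Schwarz; the
  squares of the first factor add up to \<open>2 - 2 * affinity p q\<close>.
\<close>

lemma affinity_le_of_expectation_diff:
  fixes f :: "'a \<Rightarrow> real"
  assumes fin: "finite (set_pmf p)" "finite (set_pmf q)" and "0 < M"
    and bound: "\<And>x. x \<in> set_pmf p \<union> set_pmf q \<Longrightarrow> \<bar>f x\<bar> \<le> M"
  shows "affinity p q \<le>
    1 - (measure_pmf.expectation p f - measure_pmf.expectation q f)\<^sup>2 / (8 * M\<^sup>2)"
proof -
  define S where "S = set_pmf p \<union> set_pmf q"
  have S: "finite S" "set_pmf p \<subseteq> S" "set_pmf q \<subseteq> S" using fin by (auto simp: S_def)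
  define a b where "a x = sqrt (pmf p x)" and "b x = sqrt (pmf q x)" for x
  have ab: "(a x)\<^sup>2 = pmf p x" "(b x)\<^sup>2 = pmf q x" "0 \<le> a x" "0 \<le> b x" for x
    by (auto simp: a_def b_def)
  have aff: "affinity p q = (\<Sum>x\<in>S. a x * b x)"
    using affinity_eq_sum[OF S(1,2)] by (simp add: a_def b_def real_sqrt_mult)
  have one: "(\<Sum>x\<in>S. (a x)\<^sup>2) = 1" "(\<Sum>x\<in>S. (b x)\<^sup>2) = 1"
    using sum_pmf_eq_1 S unfolding ab by blast+
  have hel: "(\<Sum>x\<in>S. (a x - b x)\<^sup>2) = 2 - 2 * affinity p q"
    by (simp add: power2_diff sum.distrib sum_subtractf one aff sum_distrib_left mult.assoc)
  have le: "(f x * (a x + b x))\<^sup>2 \<le> 2 * M\<^sup>2 * (pmf p x + pmf q x)" if "x \<in> S" for x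
  proof -
    have "(f x)\<^sup>2 \<le> M\<^sup>2"
      using bound[of x] that by (intro power2_le_iff_abs_le[THEN iffD2]) (auto simp: S_def \<open>0 < M\<close> less_imp_le)
    moreover have "(a x + b x)\<^sup>2 \<le> 2 * (pmf p x + pmf q x)"
      using sum_squares_bound[of "a x" "b x"] by (simp add: power2_sum ab)
    ultimately have "(f x)\<^sup>2 * (a x + b x)\<^sup>2 \<le> M\<^sup>2 * (2 * (pmf p x + pmf q x))"
      by (intro mult_mono) auto
    then show ?thesis by (simp only: power_mult_distrib)
  qed
  have "(measure_pmf.expectation p f - measure_pmf.expectation q f)\<^sup>2 =
    (\<Sum>x\<in>S. (a x - b x) * (f x * (a x + b x)))\<^sup>2"
    unfolding expectation_eq_sum[OF S(1,2)] expectation_eq_sum[OF S(1,3)] sum_subtractf[symmetric]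
    by (intro arg_cong[of _ _ "\<lambda>z. z\<^sup>2"] sum.cong)
       (auto simp: algebra_simps power2_eq_square simp flip: ab)
  also have "\<dots> \<le> (\<Sum>x\<in>S. (a x - b x)\<^sup>2) * (\<Sum>x\<in>S. (f x * (a x + b x))\<^sup>2)"
    by (rule Cauchy_Schwarz_ineq_sum)
  also have "\<dots> \<le> (\<Sum>x\<in>S. (a x - b x)\<^sup>2) * (\<Sum>x\<in>S. 2 * M\<^sup>2 * (pmf p x + pmf q x))"
    by (intro mult_left_mono sum_mono le sum_nonneg) auto
  also have "\<dots> = (2 - 2 * affinity p q) * (4 * M\<^sup>2)"
    unfolding hel using one by (simp add: sum.distrib ab flip: sum_distrib_left)
  finally show ?thesis using \<open>0 < M\<close> by (simp add: field_simps)
qed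

text \<open>
  When \<open>prev\<close> reads the source off the target, only one path leads to each target, so the law of a
  two-stage experiment is a product rather than a sum.
\<close>

lemma pmf_bind_recoverable:
  assumes "\<And>x y. x \<in> set_pmf p \<Longrightarrow> y \<in> set_pmf (K x) \<Longrightarrow> prev y = x"
  shows "pmf (bind_pmf p K) y = pmf p (prev y) * pmf (K (prev y)) y"
proof -
  have "pmf (bind_pmf p K) y = (\<integral>x. pmf (K x) y \<partial>p)" by (rule pmf_bind)
  also have "\<dots> = pmf p (prev y) * pmf (K (prev y)) y"
    using assms by (subst integral_measure_pmf[of "{prev y}"]) (auto simp: set_pmf_iff)
  finally show ?thesis .
qed

lemma affinity_bind:
  assumes fin: "finite (set_pmf p)" "\<And>x. x \<in> set_pmf p \<Longrightarrow> finite (set_pmf (K x))"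
    and K: "\<And>x y. x \<in> set_pmf p \<Longrightarrow> y \<in> set_pmf (K x) \<Longrightarrow> prev y = x"
    and L: "\<And>x y. x \<in> set_pmf q \<Longrightarrow> y \<in> set_pmf (L x) \<Longrightarrow> prev y = x"
  shows "affinity (bind_pmf p K) (bind_pmf q L) =
    (\<Sum>x\<in>set_pmf p. sqrt (pmf p x * pmf q x) * affinity (K x) (L x))"
proof -
  have "affinity (bind_pmf p K) (bind_pmf q L) =
    (\<Sum>x\<in>set_pmf p. \<Sum>y\<in>set_pmf (K x). sqrt (pmf (bind_pmf p K) y * pmf (bind_pmf q L) y))"
    unfolding affinity_def set_bind_pmf using fin K
    by (intro sum.UNION_disjoint) blast+
  also have "\<dots> = (\<Sum>x\<in>set_pmf p. \<Sum>y\<in>set_pmf (K x).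
      sqrt (pmf p x * pmf q x) * sqrt (pmf (K x) y * pmf (L x) y))"
  proof (intro sum.cong refl)
    fix x y assume "x \<in> set_pmf p" "y \<in> set_pmf (K x)"
    then have "prev y = x" by (rule K)
    then show "sqrt (pmf (bind_pmf p K) y * pmf (bind_pmf q L) y) =
      sqrt (pmf p x * pmf q x) * sqrt (pmf (K x) y * pmf (L x) y)"
      using pmf_bind_recoverable[of p K prev y] pmf_bind_recoverable[of q L prev y] K L
      by (simp add: real_sqrt_mult ac_simps)
  qed
  finally show ?thesis by (simp add: affinity_def sum_distrib_left)
qed

text \<open>
  A step whose kernels have affinity at most \<open>1 - c\<close> contracts the affinity by that factor.  On the
  set \<open>B\<close> of states without such a gap the trivial bound 1 is used; by Cauchy-Schwarz the
  weight \<open>\<Sum> \<surd>(p q)\<close> of \<open>B\<close> is at most the square root of its probability under \<open>p\<close> alone.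
\<close>

lemma affinity_bind_le:
  assumes fin: "finite (set_pmf p)" "\<And>x. x \<in> set_pmf p \<Longrightarrow> finite (set_pmf (K x))"
    and K: "\<And>x y. x \<in> set_pmf p \<Longrightarrow> y \<in> set_pmf (K x) \<Longrightarrow> prev y = x"
    and L: "\<And>x y. x \<in> set_pmf q \<Longrightarrow> y \<in> set_pmf (L x) \<Longrightarrow> prev y = x"
    and "0 \<le> c"
    and good: "\<And>x. x \<in> set_pmf p \<Longrightarrow> x \<notin> B \<Longrightarrow> affinity (K x) (L x) \<le> 1 - c"
  shows "affinity (bind_pmf p K) (bind_pmf q L) \<le> (1 - c) * affinity p q + c * sqrt (measure p B)"
proof -
  let ?w = "\<lambda>x. sqrt (pmf p x * pmf q x)"
  let ?S = "set_pmf p"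
  have "affinity (bind_pmf p K) (bind_pmf q L) = (\<Sum>x\<in>?S. ?w x * affinity (K x) (L x))"
    by (rule affinity_bind[OF fin K L])
  also have "\<dots> \<le> (\<Sum>x\<in>?S. (1 - c) * ?w x + (if x \<in> B then c * ?w x else 0))"
  proof (intro sum_mono)
    fix x assume x: "x \<in> ?S"
    have "affinity (K x) (L x) \<le> 1 - c + (if x \<in> B then c else 0)"
      using good[OF x] affinity_le_1[OF fin(2)[OF x]] by auto
    then have "?w x * affinity (K x) (L x) \<le> ?w x * (1 - c + (if x \<in> B then c else 0))"
      by (intro mult_left_mono) auto
    then show "?w x * affinity (K x) (L x) \<le> (1 - c) * ?w x + (if x \<in> B then c * ?w x else 0)"
      by (auto simp: algebra_simps)
  qed
  also have "\<dots> = (1 - c) * affinity p q + c * (\<Sum>x\<in>?S \<inter> B. ?w x)"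
    using fin(1) by (simp add: sum.distrib affinity_def sum_distrib_left sum.If_cases)
  also have "(\<Sum>x\<in>?S \<inter> B. ?w x) \<le> sqrt (measure p (?S \<inter> B))"
    using fin(1) by (intro sum_sqrt_pmf_le) auto
  also have "measure p (?S \<inter> B) = measure p B"
    by (metis Int_commute measure_Int_set_pmf)
  finally show ?thesis using \<open>0 \<le> c\<close> by (simp add: mult_left_mono)
qed

text \<open>
  The test decides for the larger of the two masses at each point, so its two errors add up to
  \<open>\<Sum> min p q \<le> \<Sum> \<surd>(p q)\<close>.
\<close>

lemma lr_test_error_le_affinity:
  assumes fin: "finite (set_pmf p)" and ac: "set_pmf q \<subseteq> set_pmf p"
  shows "measure_pmf.expectation p (lr_test p q) +
    measure_pmf.expectation q (\<lambda>x. 1 - lr_test p q x) \<le> affinity p q"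
proof -
  let ?R = "RN_deriv (measure_pmf p) (measure_pmf q)"
  have "absolutely_continuous (measure_pmf p) (measure_pmf q)"
    using ac by (auto simp: absolutely_continuous_def null_sets_def AE_measure_pmf_iff
        measure_pmf.emeasure_eq_measure measure_pmf_zero_iff)
  then have dens: "density (measure_pmf p) ?R = measure_pmf q"
    by (intro sigma_finite_measure.density_RN_deriv) (auto intro: measure_pmf.sigma_finite_measure_axioms)
  have R: "ennreal (pmf q x) = ?R x * ennreal (pmf p x)" for x
  proof -
    have "ennreal (pmf q x) = emeasure (density (measure_pmf p) ?R) {x}"
      unfolding dens by (simp add: emeasure_pmf_single)
    also have "\<dots> = (\<integral>\<^sup>+y. ?R x * indicator {x} y \<partial>p)"
      by (subst emeasure_density) (auto intro!: nn_integral_cong split: split_indicator)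
    also have "\<dots> = ?R x * ennreal (pmf p x)"
      by (simp add: nn_integral_cmult_indicator emeasure_pmf_single)
    finally show ?thesis .
  qed
  have min: "pmf p x * lr_test p q x + pmf q x * (1 - lr_test p q x) \<le> sqrt (pmf p x * pmf q x)" for x
  proof (cases "?R x > 1")
    case True
    have "1 * ennreal (pmf p x) \<le> ?R x * ennreal (pmf p x)"
      using True by (intro mult_right_mono) auto
    then have "pmf p x \<le> pmf q x" by (simp flip: R)
    then have "pmf p x * pmf p x \<le> pmf p x * pmf q x" by (intro mult_left_mono) auto
    then show ?thesis using True by (simp add: lr_test_def real_le_rsqrt power2_eq_square)
  next
    case False
    then have "?R x * ennreal (pmf p x) \<le> 1 * ennreal (pmf p x)"
      by (intro mult_right_mono) auto
    then have "pmf q x \<le> pmf p x" by (simp flip: R)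
    then have "pmf q x * pmf q x \<le> pmf p x * pmf q x" by (intro mult_right_mono) auto
    then show ?thesis using False by (simp add: lr_test_def real_le_rsqrt power2_eq_square)
  qed
  show ?thesis
    unfolding expectation_eq_sum[OF fin order_refl] expectation_eq_sum[OF fin ac]
      sum.distrib[symmetric] affinity_def
    by (intro sum_mono min)
qed

lemma set_pmf_subset_of_pmf_le:
  assumes "\<And>x. pmf q x \<le> c * pmf p x"
  shows "set_pmf q \<subseteq> set_pmf p"
proof
  fix x assume "x \<in> set_pmf q"
  then have "0 < c * pmf p x" using assms[of x] pmf_positive[of x q] by linarith
  then show "x \<in> set_pmf p" by (auto simp: set_pmf_iff)
qed

lemma pmf_bind_le:
  assumes fin: "finite (set_pmf p)" and "0 \<le> c" "0 \<le> d"
    and p: "\<And>x. pmf p' x \<le> c * pmf p x"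
    and K: "\<And>x y. x \<in> set_pmf p' \<Longrightarrow> pmf (K' x) y \<le> d * pmf (K x) y"
  shows "pmf (bind_pmf p' K') y \<le> c * d * pmf (bind_pmf p K) y"
proof -
  have sub: "set_pmf p' \<subseteq> set_pmf p"
    using p by (rule set_pmf_subset_of_pmf_le)
  have "pmf (bind_pmf p' K') y = (\<Sum>x\<in>set_pmf p. pmf p' x * pmf (K' x) y)"
    unfolding pmf_bind by (rule expectation_eq_sum[OF fin sub])
  also have "\<dots> \<le> (\<Sum>x\<in>set_pmf p. (c * pmf p x) * (d * pmf (K x) y))"
  proof (intro sum_mono)
    fix x
    show "pmf p' x * pmf (K' x) y \<le> (c * pmf p x) * (d * pmf (K x) y)"
    proof (cases "x \<in> set_pmf p'")
      case True
      then show ?thesis using p K \<open>0 \<le> c\<close> by (intro mult_mono) auto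
    next
      case False
      then show ?thesis using \<open>0 \<le> c\<close> \<open>0 \<le> d\<close> by (simp add: set_pmf_iff)
    qed
  qed
  also have "\<dots> = c * d * (\<Sum>x\<in>set_pmf p. pmf p x * pmf (K x) y)"
    by (simp add: sum_distrib_left ac_simps)
  also have "\<dots> = c * d * pmf (bind_pmf p K) y"
    unfolding pmf_bind by (simp add: expectation_eq_sum[OF fin order_refl])
  finally show ?thesis .
qed

lemma prob_le_of_pmf_le:
  assumes "finite (set_pmf p)" "\<And>x. pmf q x \<le> c * pmf p x"
  shows "measure q E \<le> c * measure p E"
proof -
  have sub: "set_pmf q \<subseteq> set_pmf p"
    using assms(2) by (rule set_pmf_subset_of_pmf_le)
  have eq: "measure r E = (\<Sum>x\<in>set_pmf p \<inter> E. pmf r x)" if "set_pmf r \<subseteq> set_pmf p" for r :: "'a pmf"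
  proof -
    have "measure r E = measure r (E \<inter> set_pmf r)" by (simp add: measure_Int_set_pmf)
    also have "\<dots> = (\<Sum>x\<in>E \<inter> set_pmf r. pmf r x)"
      using finite_subset[OF that assms(1)] by (intro measure_measure_pmf_finite) auto
    also have "\<dots> = (\<Sum>x\<in>set_pmf p \<inter> E. pmf r x)"
      using that assms(1) by (intro sum.mono_neutral_left) (auto simp: set_pmf_iff)
    finally show ?thesis .
  qed
  show ?thesis
    unfolding eq[OF sub] eq[OF order_refl] sum_distrib_left by (intro sum_mono assms)
qed

section \<open>The final graphs as a Markov chain\<close>

text \<open>
  The transition kernel from \<open>G\<^sub>t\<^sub>-\<^sub>1\<close> to \<open>G\<^sub>t\<^sub>,\<^sub>i\<close>: the process with the
  trajectory forgotten.
\<close>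

primrec attach_arcs :: "nat \<Rightarrow> real \<Rightarrow> nat \<Rightarrow> nat \<Rightarrow> lgraph \<Rightarrow> lgraph pmf" where
  "attach_arcs m d t 0 g = return_pmf (add_vertex t g)"
| "attach_arcs m d t (Suc i) g =
     bind_pmf (attach_arcs m d t i g) (\<lambda>h. map_pmf (\<lambda>v. add_arc t v h) (attach_pmf m d t (Suc i) h))"

definition graph_law :: "nat \<Rightarrow> (nat \<Rightarrow> real) \<Rightarrow> nat \<Rightarrow> lgraph pmf" where
  "graph_law m \<delta> n = map_pmf (graph_at m n) (pa_process m \<delta> n)"

lemma map_pa_arcs:
  "map_pmf (\<lambda>H. H (t, i)) (pa_arcs m \<delta> t i G) = attach_arcs m (\<delta> t) t i (G (t - 1, m))"
proof (induction i)
  case (Suc i)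
  have "map_pmf (\<lambda>H. H (t, Suc i)) (pa_arcs m \<delta> t (Suc i) G) =
    bind_pmf (map_pmf (\<lambda>H. H (t, i)) (pa_arcs m \<delta> t i G))
      (\<lambda>h. map_pmf (\<lambda>v. add_arc t v h) (attach_pmf m (\<delta> t) t (Suc i) h))"
    by (simp add: map_bind_pmf bind_map_pmf map_pmf_def[of "\<lambda>v. add_arc _ v _"])
  then show ?case by (simp add: Suc.IH)
qed simp

lemma graph_law_Suc:
  assumes "1 \<le> n"
  shows "graph_law m \<delta> (Suc n) =
    bind_pmf (graph_law m \<delta> n) (attach_arcs m (\<delta> (Suc n)) (Suc n) m)"
proof -
  obtain k where k: "n = Suc k" using assms by (cases n) auto
  have "graph_at m (Suc (Suc k)) = (\<lambda>H. H (Suc (Suc k), m))"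
    by (simp add: graph_at_def fun_eq_iff)
  then show ?thesis
    by (simp add: k graph_law_def map_bind_pmf bind_map_pmf map_pa_arcs graph_at_def)
qed

lemma graph_law_1: "\<exists>g. graph_law m \<delta> (Suc 0) = return_pmf g"
  by (simp add: graph_law_def)

lemma graph_law_valid:
  assumes "\<And>t. \<delta> t > - real m" "1 \<le> n" "g \<in> set_pmf (graph_law m \<delta> n)"
  shows "pa_valid m n m g"
  using pa_process_valid[of m \<delta> n] assms by (auto simp: graph_law_def)

lemma attach_arcs_valid:
  assumes "pa_valid m t m g" "1 \<le> t" "d > - real m" "h \<in> set_pmf (attach_arcs m d (Suc t) i g)"
  shows "pa_valid m (Suc t) i h"
proof -
  have "h \<in> set_pmf (map_pmf (\<lambda>H. H (Suc t, i)) (pa_arcs m (\<lambda>_. d) (Suc t) i (\<lambda>_. g)))"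
    using assms(4) by (simp add: map_pa_arcs del: set_map_pmf)
  then show ?thesis
    using pa_arcs_valid[of m "\<lambda>_. d" t "\<lambda>_. g"] assms by auto
qed

lemma set_attach_pmf:
  assumes "pa_valid m t i g" "d > - real m" "2 \<le> t"
  shows "set_pmf (attach_pmf m d t (Suc i) g) \<subseteq> {..<t}"
  using pmf_attach_pmf[OF assms] by (auto simp: set_pmf_iff split: if_splits)

lemma finite_attach_arcs:
  assumes "pa_valid m t m g" "1 \<le> t" "d > - real m"
  shows "finite (set_pmf (attach_arcs m d (Suc t) i g))"
proof (induction i)
  case (Suc i)
  have "finite (set_pmf (attach_pmf m d (Suc t) (Suc i) h))"
    if "h \<in> set_pmf (attach_arcs m d (Suc t) i g)" for h
    by (rule finite_subset[OF set_attach_pmf[OF attach_arcs_valid[OF assms that] assms(3)]])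
       (use assms(2) in auto)
  then show ?case using Suc by auto
qed simp

lemma finite_graph_law:
  assumes "\<And>t. \<delta> t > - real m" "1 \<le> n"
  shows "finite (set_pmf (graph_law m \<delta> n))"
  using assms(2)
proof (induction n rule: nat_induct_at_least)
  case base
  then show ?case using graph_law_1[of m \<delta>] by auto
next
  case (Suc n)
  then show ?case
    using finite_attach_arcs graph_law_valid[of m \<delta> n] assms(1) by (auto simp: graph_law_Suc)
qed

definition remove_vertex :: "nat \<Rightarrow> lgraph \<Rightarrow> lgraph" where
  "remove_vertex t g = LGraph (verts g - {t}) {#e \<in># arcs g. fst e \<noteq> t#}"

lemma remove_vertex_attach_arcs:
  "h \<in> set_pmf (attach_arcs m d t i g) \<Longrightarrow> remove_vertex t h = remove_vertex t g"
proof (induction i arbitrary: h)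
  case (Suc i)
  then obtain h' v where "h' \<in> set_pmf (attach_arcs m d t i g)" "h = add_arc t v h'"
    by auto
  then show ?case using Suc.IH[of h'] by (simp add: remove_vertex_def add_arc_def)
qed (auto simp: remove_vertex_def add_vertex_def)

lemma remove_vertex_valid:
  assumes "pa_valid m t i g"
  shows "remove_vertex (Suc t) g = g"
proof -
  have "{#e \<in># arcs g. fst e \<noteq> Suc t#} = arcs g"
    using assms by (subst filter_mset_eq_conv) (fastforce simp: pa_valid_def)
  then show ?thesis
    using assms by (cases g) (auto simp: remove_vertex_def pa_valid_def)
qed

text \<open>
  All arcs out of vertex \<open>n + 1\<close> are added in its own step, so removing them and the vertex undoes
  the step.
\<close>

lemma graph_law_recoverable:
  assumes "\<And>t. \<delta> t > - real m" "1 \<le> n"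
    and "g \<in> set_pmf (graph_law m \<delta> n)" "h \<in> set_pmf (attach_arcs m d (Suc n) m g)"
  shows "remove_vertex (Suc n) h = g"
  using remove_vertex_attach_arcs[OF assms(4)] remove_vertex_valid[OF graph_law_valid[OF assms(1-3)]]
  by simp

section \<open>The total degree of a set of vertices\<close>

definition vol :: "nat set \<Rightarrow> lgraph \<Rightarrow> real" where
  "vol A g = (\<Sum>v\<in>A. real (degree g v))"

lemma vol_add_vertex [simp]: "vol A (add_vertex t g) = vol A g"
  by (simp add: vol_def)

lemma vol_add_arc:
  assumes "finite A" "t \<notin> A"
  shows "vol A (add_arc t v g) = vol A g + of_bool (v \<in> A)"
proof -
  have "vol A (add_arc t v g) = (\<Sum>w\<in>A. real (degree g w) + of_bool (w = v))"
    unfolding vol_def using assms(2) by (intro sum.cong) (auto simp: degree_add_arc)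
  also have "\<dots> = vol A g + of_bool (v \<in> A)"
    unfolding sum.distrib vol_def using assms(1) by (simp add: of_bool_def sum.delta)
  finally show ?thesis .
qed

text \<open>
  The weight \<open>vol A + d * card A\<close> against the total weight is a Polya urn: each draw adds 1 to the
  total, and adds 1 to the weight of \<open>A\<close> with probability their ratio.  So the ratio is a
  martingale, and the mean weight grows like the total weight \<open>D + i\<close>.
\<close>

lemma expectation_vol_attach_arcs:
  assumes g: "pa_valid m t m g" and t: "1 \<le> t" and d: "d > - real m" and A: "A \<subseteq> {..t}"
  defines "D \<equiv> 2 * real m * real t + d * (real t + 1)"
  shows "measure_pmf.expectation (attach_arcs m d (Suc t) i g) (\<lambda>h. vol A h + d * card A) =
    (vol A g + d * card A) * ((D + i) / D)"
proof (induction i)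
  case 0
  have "0 < D" using attach_denominator_pos[of m d "Suc t" 0] t d by (simp add: D_def algebra_simps)
  then show ?case by simp
next
  case (Suc i)
  have D: "0 < D + real j" for j
    using attach_denominator_pos[of m d "Suc t" j] t d by (simp add: D_def algebra_simps)
  have D0: "0 < D" using D[of 0] by simp
  have finA: "finite A" using A finite_subset by blast
  have notin: "Suc t \<notin> A" using A by auto
  let ?p = "attach_arcs m d (Suc t) i g"
  let ?W = "\<lambda>h. vol A h + d * card A"
  let ?K = "\<lambda>h. attach_pmf m d (Suc t) (Suc i) h"
  have sub: "set_pmf (?K h) \<subseteq> {..<Suc t}" if "h \<in> set_pmf ?p" for h
    using set_attach_pmf[OF attach_arcs_valid[OF g t d that] d] t by simp
  then have finK: "finite (set_pmf (?K h))" if "h \<in> set_pmf ?p" for h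
    using that finite_subset by blast
  have step: "measure_pmf.expectation (map_pmf (\<lambda>v. add_arc (Suc t) v h) (?K h)) ?W =
      ?W h * (1 + 1 / (D + i))" if h: "h \<in> set_pmf ?p" for h
  proof -
    note val = attach_arcs_valid[OF g t d h]
    have pmf: "pmf (?K h) v = (real (degree h v) + d) / (D + i)" if "v < Suc t" for v
      using that pmf_attach_pmf[OF val d, of v] t by (simp add: D_def algebra_simps)
    have "measure_pmf.expectation (map_pmf (\<lambda>v. add_arc (Suc t) v h) (?K h)) ?W =
        (\<Sum>v<Suc t. pmf (?K h) v * (?W h + of_bool (v \<in> A)))"
      unfolding integral_map_pmf
      by (subst expectation_eq_sum[OF _ sub[OF h]])
         (auto simp: vol_add_arc[OF finA notin] algebra_simps)
    also have "\<dots> = ?W h * (\<Sum>v<Suc t. pmf (?K h) v) + (\<Sum>v<Suc t. pmf (?K h) v * of_bool (v \<in> A))"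
      by (simp add: ring_distribs sum.distrib sum_distrib_left sum_distrib_right ac_simps)
    also have "(\<Sum>v<Suc t. pmf (?K h) v) = 1"
      using sub[OF h] by (intro sum_pmf_eq_1) auto
    also have "(\<Sum>v<Suc t. pmf (?K h) v * of_bool (v \<in> A)) = (\<Sum>v\<in>A. pmf (?K h) v)"
      using A by (intro sum.mono_neutral_cong_right) (auto simp: of_bool_def)
    also have "\<dots> = (\<Sum>v\<in>A. (real (degree h v) + d) / (D + i))"
      using A by (intro sum.cong pmf refl) auto
    also have "\<dots> = ?W h / (D + i)"
      by (simp add: vol_def sum.distrib flip: sum_divide_distrib)
    finally show ?thesis by (simp only: ring_distribs mult_1_right times_divide_eq_right)
  qed
  have "measure_pmf.expectation (attach_arcs m d (Suc t) (Suc i) g) ?W =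
      measure_pmf.expectation ?p (\<lambda>h. measure_pmf.expectation (map_pmf (\<lambda>v. add_arc (Suc t) v h) (?K h)) ?W)"
    unfolding attach_arcs.simps
    by (rule expectation_bind_finite) (use finite_attach_arcs[OF g t d] finK in auto)
  also have "\<dots> = measure_pmf.expectation ?p (\<lambda>h. ?W h * (1 + 1 / (D + i)))"
    by (intro integral_cong_AE) (simp_all add: AE_measure_pmf_iff step del: integral_map_pmf)
  also have "\<dots> = measure_pmf.expectation ?p ?W * (1 + 1 / (D + i))"
    by simp
  also have "\<dots> = ?W g * ((D + i) / D) * (1 + 1 / (D + i))"
    by (simp only: Suc.IH)
  also have "1 + 1 / (D + i) = (D + Suc i) / (D + i)"
    using D[of i] by (simp add: field_simps)
  also have "?W g * ((D + i) / D) * ((D + Suc i) / (D + i)) = ?W g * ((D + Suc i) / D)"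
    using D[of i] by simp
  finally show ?case .
qed

lemma expectation_vol_attach_all:
  assumes g: "pa_valid m t m g" and t: "1 \<le> t" and d: "d > - real m" and A: "A \<subseteq> {..t}"
  shows "measure_pmf.expectation (attach_arcs m d (Suc t) m g) (vol A) =
    vol A g + real m * (vol A g + d * card A) / (2 * real m * real t + d * (real t + 1))"
proof -
  let ?D = "2 * real m * real t + d * (real t + 1)"
  have D: "0 < ?D" using attach_denominator_pos[of m d "Suc t" 0] t d by (simp add: algebra_simps)
  have "measure_pmf.expectation (attach_arcs m d (Suc t) m g) (\<lambda>h. vol A h + d * card A) =
    measure_pmf.expectation (attach_arcs m d (Suc t) m g) (vol A) + d * card A"
    using finite_attach_arcs[OF g t d] by (simp add: integrable_measure_pmf_finite)
  then show ?thesis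
    using D unfolding expectation_vol_attach_arcs[OF assms] by (simp add: field_simps)
qed

section \<open>Recent vertices receive few arcs\<close>

text \<open>
  The \<open>j\<close> vertices after \<open>s\<close> have \<open>m * j\<close> outgoing arcs in all.  An arc from a new vertex enters this
  set with probability of order \<open>j / s\<close>, so the mean number of arcs inside the set is of order
  \<open>j\<^sup>2 / s\<close>, negligible against \<open>m * j\<close> when \<open>j\<close> is much smaller than \<open>s\<close>.  The bound is
  self-improving: for \<open>j \<le> s\<close> it gives a mean volume of at most \<open>2 * m * j\<close>, which is what the
  next step of the induction needs, whatever the sign of \<open>d\<close>.
\<close>

lemma expectation_recent_vol_le:
  assumes d: "d > - real m" and s: "1 \<le> s" and j: "j \<le> s"
  shows "measure_pmf.expectation (graph_law m (\<lambda>_. d) (s + j)) (vol {s<..s + j}) \<le>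
    real m * j + real m * (real j)\<^sup>2 / s"
  using j
proof (induction j)
  case 0
  then show ?case by (simp add: vol_def)
next
  case (Suc j)
  let ?p = "graph_law m (\<lambda>_. d) (s + j)"
  let ?A = "{s<..s + j}"
  let ?D = "2 * real m * real (s + j) + d * (real (s + j) + 1)"
  have A: "?A \<subseteq> {..s + j}" by auto
  define e where "e = measure_pmf.expectation ?p (vol ?A)"
  have D: "0 < ?D"
    using attach_denominator_pos[of m d "Suc (s + j)" 0] s d by (simp add: algebra_simps)
  have fin: "finite (set_pmf ?p)" using finite_graph_law[of m "\<lambda>_. d"] d s by simp
  have val: "pa_valid m (s + j) m g" if "g \<in> set_pmf ?p" for g
    using graph_law_valid[of m "\<lambda>_. d"] d s that by simp
  have step: "measure_pmf.expectation (attach_arcs m d (Suc (s + j)) m g) (vol {s<..s + Suc j}) =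
      vol ?A g + real m * (vol ?A g + d * j) / ?D + m" if g: "g \<in> set_pmf ?p" for g
  proof -
    have fin': "finite (set_pmf (attach_arcs m d (Suc (s + j)) m g))"
      using finite_attach_arcs[OF val[OF g] _ d] s by simp
    have "measure_pmf.expectation (attach_arcs m d (Suc (s + j)) m g) (vol {s<..s + Suc j}) =
      measure_pmf.expectation (attach_arcs m d (Suc (s + j)) m g) (\<lambda>h. vol ?A h + m)"
    proof (intro integral_cong_AE AE_pmfI)
      fix h assume "h \<in> set_pmf (attach_arcs m d (Suc (s + j)) m g)"
      then have "degree h (Suc (s + j)) = m"
        using attach_arcs_valid[OF val[OF g] _ d] s by (auto simp: pa_valid_def)
      moreover have "{s<..s + Suc j} = insert (Suc (s + j)) ?A" by auto
      ultimately show "vol {s<..s + Suc j} h = vol ?A h + m" by (simp add: vol_def)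
    qed auto
    also have "\<dots> = measure_pmf.expectation (attach_arcs m d (Suc (s + j)) m g) (vol ?A) + m"
      using fin' by (simp add: integrable_measure_pmf_finite)
    also have "\<dots> = vol ?A g + real m * (vol ?A g + d * j) / ?D + m"
      using expectation_vol_attach_all[OF val[OF g] _ d A] s by simp
    finally show ?thesis .
  qed
  have "measure_pmf.expectation (graph_law m (\<lambda>_. d) (s + Suc j)) (vol {s<..s + Suc j}) =
    measure_pmf.expectation ?p (\<lambda>g. measure_pmf.expectation (attach_arcs m d (Suc (s + j)) m g) (vol {s<..s + Suc j}))"
    using s finite_attach_arcs[OF val _ d]
    by (simp add: graph_law_Suc expectation_bind_finite[OF fin])
  also have "\<dots> = measure_pmf.expectation ?p (\<lambda>g. vol ?A g + real m * (vol ?A g + d * j) / ?D + m)"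
    by (intro integral_cong_AE AE_pmfI) (use step in auto)
  also have "\<dots> = e + real m * (e + d * j) / ?D + m"
    using fin by (simp add: integrable_measure_pmf_finite e_def)
  also have "\<dots> \<le> real m * Suc j + real m * (real (Suc j))\<^sup>2 / s"
  proof (cases "j = 0")
    case True
    moreover have "vol {} = (\<lambda>_. 0)" by (simp add: vol_def fun_eq_iff)
    ultimately show ?thesis using s by (simp add: e_def)
  next
    case False
    have e: "e \<le> real m * j + real m * (real j)\<^sup>2 / s"
      using Suc by (simp add: e_def)
    have "(real j)\<^sup>2 / s \<le> j"
      using Suc.prems s mult_left_mono[of "real j" "real s" "real j"]
      by (simp add: field_simps power2_eq_square)
    then have "real m * ((real j)\<^sup>2 / s) \<le> real m * j" by (intro mult_left_mono) auto
    then have "e + d * j \<le> (2 * real m + d) * j" using e by (simp add: algebra_simps)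
    moreover have "(2 * real m + d) * s \<le> ?D"
    proof -
      \<comment> \<open>This sum is exactly the difference of the two sides of the claim.\<close>
      have "0 \<le> (2 * real m + d) * (real j - 1) + 2 * (m + d)"
        using False d by (intro add_nonneg_nonneg[OF mult_nonneg_nonneg[of "2 * real m + d"]]) (linarith | simp)+
      then show ?thesis by (simp add: algebra_simps)
    qed
    ultimately have "(e + d * j) * s \<le> j * ?D"
    proof -
      have "(e + d * j) * s \<le> (2 * real m + d) * j * s"
        using \<open>e + d * j \<le> (2 * real m + d) * j\<close> by (intro mult_right_mono) auto
      also have "\<dots> = j * ((2 * real m + d) * s)" by simp
      also have "\<dots> \<le> j * ?D"
        using \<open>(2 * real m + d) * s \<le> ?D\<close> by (intro mult_left_mono) auto
      finally show ?thesis .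
    qed
    then have "(e + d * j) / ?D \<le> j / s"
      using s by (subst pos_divide_le_eq[OF D], subst times_divide_eq_left, subst pos_le_divide_eq) simp_all
    then have "real m * ((e + d * j) / ?D) \<le> real m * (j / s)" by (intro mult_left_mono) auto
    then have "e + real m * (e + d * j) / ?D + m \<le>
        real m * j + real m * (real j)\<^sup>2 / s + real m * j / s + m"
      using e by simp
    also have "\<dots> = real m * Suc j + real m * ((real j)\<^sup>2 + j) / s"
      by (simp add: ring_distribs add_divide_distrib)
    also have "\<dots> \<le> real m * Suc j + real m * (real (Suc j))\<^sup>2 / s"
    proof -
      have "(real j)\<^sup>2 + j \<le> (real (Suc j))\<^sup>2" by (simp add: power2_eq_square algebra_simps)
      then show ?thesis by (simp add: divide_right_mono mult_left_mono)
    qed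
    finally show ?thesis .
  qed
  finally show ?case .
qed

text \<open>
  Markov's inequality for the number of arcs inside the set of young vertices, which is the
  excess of the volume over \<open>m * j\<close>.
\<close>

lemma prob_recent_vol_large_le:
  assumes m: "1 \<le> m" and d: "d > - real m" and s: "1 \<le> s" and j: "1 \<le> j" "j \<le> s"
  shows "measure (graph_law m (\<lambda>_. d) (s + j)) {g. 3 / 2 * real m * real j \<le> vol {s<..s + j} g} \<le>
       2 * real j / real s"
proof -
  let ?p = "graph_law m (\<lambda>_. d) (s + j)"
  let ?f = "\<lambda>g. vol {s<..s + j} g - real m * j"
  have fin: "finite (set_pmf ?p)" using finite_graph_law[of m "\<lambda>_. d"] d s by simp
  have nonneg: "0 \<le> ?f g" if g: "g \<in> set_pmf ?p" for g
  proof -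
    have "pa_valid m (s + j) m g"
      using graph_law_valid[of m "\<lambda>_. d"] d s g by simp
    then have "m \<le> degree g v" if "v \<le> s + j" for v
      using that by (cases "v = s + j") (auto simp: pa_valid_def)
    then have "(\<Sum>v\<in>{s<..s + j}. real m) \<le> vol {s<..s + j} g"
      unfolding vol_def by (intro sum_mono) auto
    then show ?thesis by (simp add: mult.commute)
  qed
  have "measure ?p {g. 3 / 2 * real m * real j \<le> vol {s<..s + j} g} =
      measure ?p {g \<in> space ?p. real m * real j / 2 \<le> ?f g}"
    by (intro arg_cong[of _ _ "measure ?p"]) (auto simp: mult.commute)
  also have "\<dots> \<le> measure_pmf.expectation ?p ?f / (real m * real j / 2)"
    by (rule integral_Markov_inequality_measure[where A="UNIV"])
       (use fin nonneg m j in \<open>auto simp: integrable_measure_pmf_finite AE_measure_pmf_iff\<close>)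
  also have "\<dots> \<le> (real m * (real j)\<^sup>2 / s) / (real m * real j / 2)"
    using expectation_recent_vol_le[OF d s j(2)] fin
    by (intro divide_right_mono) (auto simp: integrable_measure_pmf_finite)
  also have "\<dots> = 2 * real j / real s"
    using m j s by (simp add: field_simps power2_eq_square)
  finally show ?thesis .
qed

section \<open>One step after the change loses affinity\<close>

text \<open>
  Let \<open>a = card A\<close>, \<open>v = vol A g\<close> and \<open>D d = 2 * m * u + d * (u + 1)\<close>.  The mean number of arcs from
  the new vertex to \<open>A\<close> is \<open>m * (v + d * a) / D d\<close>; between \<open>d0\<close> and \<open>d1\<close> it changes by a multiple
  of \<open>a * (2 * m * u) - v * (u + 1)\<close>, which measures how far the average degree in \<open>A\<close> is from that in
  the graph.  The hypothesis \<open>small\<close> keeps it of order \<open>a * m * u\<close>.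
\<close>

lemma affinity_attach_arcs_le:
  assumes g: "pa_valid m u m g" and m: "1 \<le> m" and d: "d0 > - real m" "d1 > - real m"
    and u: "6 \<le> u" and A: "A \<subseteq> {..u}" and small: "vol A g \<le> 3 / 2 * real m * real (card A)"
  defines "L \<equiv> 2 * real m + 2 * \<bar>d0\<bar> + 2 * \<bar>d1\<bar>"
  shows "affinity (attach_arcs m d0 (Suc u) m g) (attach_arcs m d1 (Suc u) m g) \<le>
    1 - (real m * \<bar>d1 - d0\<bar> / (4 * L\<^sup>2) * (real (card A) / real u))\<^sup>2 / 8"
proof -
  let ?p = "\<lambda>d. attach_arcs m d (Suc u) m g"
  let ?f = "\<lambda>h. vol A h - vol A g"
  let ?D = "\<lambda>d. 2 * real m * real u + d * (real u + 1)"
  define a v where "a = real (card A)" and "v = vol A g"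
  have u1: "1 \<le> u" using u by simp
  have fin: "finite (set_pmf (?p d0))" "finite (set_pmf (?p d1))"
    using finite_attach_arcs[OF g u1] d by auto
  have L: "0 < L" using m by (simp add: L_def)
  have D: "0 < ?D d" "?D d \<le> L * u" if "d = d0 \<or> d = d1" for d
  proof -
    show "0 < ?D d"
      using attach_denominator_pos[of m d "Suc u" 0] u1 d that by (auto simp: algebra_simps)
    have "d * (real u + 1) \<le> \<bar>d\<bar> * (2 * u)"
      using u1 by (intro mult_mono) auto
    also have "\<dots> \<le> (2 * \<bar>d0\<bar> + 2 * \<bar>d1\<bar>) * u"
      using that by (auto simp: algebra_simps)
    finally show "?D d \<le> L * u" by (simp add: L_def algebra_simps)
  qed
  have bound: "\<bar>?f h\<bar> \<le> m" if h: "h \<in> set_pmf (?p d0) \<union> set_pmf (?p d1)" for h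
  proof -
    have *: "0 \<le> vol A h - vol A g \<and> vol A h - vol A g \<le> i"
      if "h \<in> set_pmf (attach_arcs m d (Suc u) i g)" for d i
      using that
    proof (induction i arbitrary: h)
      case (Suc i)
      then obtain h' v where "h' \<in> set_pmf (attach_arcs m d (Suc u) i g)" "h = add_arc (Suc u) v h'"
        by auto
      moreover have "finite A" "Suc u \<notin> A" using A finite_subset by auto
      ultimately show ?case
        using Suc.IH[of h'] vol_add_arc[of A "Suc u" v h'] by auto
    qed simp
    show ?thesis using h *[of d0 m] *[of d1 m] by auto
  qed
  have E: "measure_pmf.expectation (?p d) ?f = m * (v + d * a) / ?D d" if "d = d0 \<or> d = d1" for d
  proof -
    have "measure_pmf.expectation (?p d) ?f = measure_pmf.expectation (?p d) (vol A) - vol A g"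
      using fin that by (auto simp: integrable_measure_pmf_finite)
    then show ?thesis
      using expectation_vol_attach_all[OF g u1 _ A, of d] that d by (auto simp: a_def v_def)
  qed
  define x where "x = measure_pmf.expectation (?p d0) ?f - measure_pmf.expectation (?p d1) ?f"
  define y where "y = real m * \<bar>d1 - d0\<bar> / (4 * L\<^sup>2) * (a / u)"
  have x: "x = m * (d0 - d1) * (a * (2 * real m * u) - v * (u + 1)) / (?D d0 * ?D d1)"
    using D[of d0] D[of d1] by (simp add: x_def E diff_frac_eq) (simp add: algebra_simps)
  have gap: "a * m * u / 4 \<le> a * (2 * real m * u) - v * (u + 1)"
  proof -
    have "v * (u + 1) \<le> 3 / 2 * real m * a * (u + 1)"
      using small by (intro mult_right_mono) (auto simp: a_def v_def)
    \<comment> \<open>Here \<open>u \<ge> 6\<close> absorbs the difference between \<open>u\<close> and \<open>u + 1\<close>.\<close>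
    moreover have "0 \<le> m * a * (u / 4 - 3 / 2)"
      using u by (intro mult_nonneg_nonneg) (auto simp: a_def)
    ultimately show ?thesis by (simp add: algebra_simps)
  qed
  then have gap0: "0 \<le> a * (2 * real m * u) - v * (u + 1)"
    by (rule order_trans[rotated]) (simp add: a_def)
  have "?D d0 * ?D d1 \<le> (L * u) * (L * u)"
    using D[of d0] D[of d1] by (intro mult_mono) auto
  then have "real m * \<bar>d1 - d0\<bar> * (a * m * u / 4) / ((L * u) * (L * u)) \<le>
      m * \<bar>d1 - d0\<bar> * (a * (2 * real m * u) - v * (u + 1)) / (?D d0 * ?D d1)"
    using D[of d0] D[of d1] gap gap0 by (intro frac_le mult_left_mono mult_pos_pos mult_nonneg_nonneg) auto
  also have "\<dots> \<le> \<bar>x\<bar>"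
    unfolding x using D[of d0] D[of d1] gap0 by (simp add: abs_mult abs_minus_commute)
  also have "real m * \<bar>d1 - d0\<bar> * (a * m * u / 4) / ((L * u) * (L * u)) = m * y"
    unfolding y_def using u L by (simp add: field_simps power2_eq_square)
  finally have "(m * y)\<^sup>2 \<le> x\<^sup>2"
    by (intro abs_le_square_iff[THEN iffD1]) (auto simp: a_def y_def abs_mult)
  then have "y\<^sup>2 * (real m)\<^sup>2 \<le> x\<^sup>2" by (simp add: power_mult_distrib mult.commute)
  then have "y\<^sup>2 \<le> x\<^sup>2 / (real m)\<^sup>2" using m by (subst pos_le_divide_eq) auto
  moreover have "affinity (?p d0) (?p d1) \<le> 1 - x\<^sup>2 / (8 * (real m)\<^sup>2)"
    unfolding x_def using bound m by (intro affinity_le_of_expectation_diff fin) auto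
  ultimately show ?thesis by (simp add: y_def a_def)
qed

text \<open>
  The contraction is iterated \<open>j\<close> times from the change point, where the affinity is at most 1.
  At time \<open>u\<close> the youngest \<open>u div k\<close> vertices are observed: a fixed fraction of all, so that
  the loss \<open>c\<close> does not depend on \<open>u\<close>, and small enough for the exceptional probability to
  be below \<open>4 / k\<close>.
\<close>

lemma affinity_graph_law_le:
  assumes m: "1 \<le> m" and d: "d0 > - real m" "d1 > - real m" and k: "2 \<le> k"
    and \<tau>: "6 \<le> \<tau>" "k \<le> \<tau>"
    and \<delta>: "\<And>t. \<delta> t > - real m" "\<And>t. t > \<tau> \<Longrightarrow> \<delta> t = d1"
  defines "L \<equiv> 2 * real m + 2 * \<bar>d0\<bar> + 2 * \<bar>d1\<bar>"
  defines "c \<equiv> min 1 ((real m * \<bar>d1 - d0\<bar> / (8 * L\<^sup>2 * k))\<^sup>2 / 8)"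
  shows "affinity (graph_law m (\<lambda>_. d0) (\<tau> + j)) (graph_law m \<delta> (\<tau> + j)) \<le>
       (1 - c) ^ j + sqrt (4 / real k)"
proof (induction j)
  case 0
  have "affinity (graph_law m (\<lambda>_. d0) \<tau>) (graph_law m \<delta> \<tau>) \<le> 1"
    using finite_graph_law[of m "\<lambda>_. d0"] d \<tau> by (intro affinity_le_1) auto
  then show ?case by (simp add: add_increasing2)
next
  case (Suc j)
  let ?u = "\<tau> + j"
  let ?p = "graph_law m (\<lambda>_. d0) ?u" and ?q = "graph_law m \<delta> ?u"
  define a s where "a = ?u div k" and "s = ?u - ?u div k"
  have u: "?u = s + a" "6 \<le> ?u" "1 \<le> ?u" using \<tau> by (auto simp: a_def s_def)
  have ak: "a * k \<le> ?u" by (simp add: a_def)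
  \<comment> \<open>Rounding loses at most a factor 2: \<open>a\<close> is between \<open>u / (2 * k)\<close> and \<open>u / k\<close>.\<close>
  have uk: "?u \<le> 2 * a * k"
  proof -
    have "1 \<le> a" using \<tau> k by (simp add: a_def Suc_le_eq div_greater_zero_iff)
    moreover have "?u < (a + 1) * k"
      using k by (metis a_def add.commute dividend_less_times_div mult.commute mult_Suc_right Suc_eq_plus1 zero_less_numeral order_less_le_trans)
    moreover have "(a + 1) * k \<le> 2 * a * k" using \<open>1 \<le> a\<close> by (intro mult_right_mono) auto
    ultimately show ?thesis by linarith
  qed
  have a1: "1 \<le> a" using uk u by (cases a) auto
  have us: "?u \<le> 2 * s"
  proof -
    have "2 * a \<le> a * k" using k by simp
    then show ?thesis using ak u by linarith
  qed
  have s: "1 \<le> s" "a \<le> s" using us u by auto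
  define B where "B = {g. 3 / 2 * real m * real a \<le> vol {s<..s + a} g}"
  \<comment> \<open>The cap at 1 in \<open>c\<close> keeps \<open>1 - c\<close> nonnegative, so that the induction hypothesis can be
    multiplied by it.\<close>
  have c: "0 \<le> c" "c \<le> 1" by (auto simp: c_def)
  have "measure ?p B \<le> 2 * real a / real s"
    unfolding B_def u(1) by (rule prob_recent_vol_large_le[OF m d(1) s(1) a1 s(2)])
  also have "\<dots> \<le> 4 / real k"
  proof -
    have "a * k \<le> 2 * s" using ak us by linarith
    then have "real a * real k \<le> 2 * real s" by (metis of_nat_le_iff of_nat_mult of_nat_numeral)
    then show ?thesis using s k by (simp add: field_simps)
  qed
  finally have B: "sqrt (measure ?p B) \<le> sqrt (4 / real k)" by simp
  have good: "affinity (attach_arcs m d0 (Suc ?u) m g) (attach_arcs m d1 (Suc ?u) m g) \<le> 1 - c"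
    if "g \<in> set_pmf ?p" "g \<notin> B" for g
  proof -
    have val: "pa_valid m ?u m g"
      using graph_law_valid[of m "\<lambda>_. d0"] d u that by simp
    have A: "{s<..s + a} \<subseteq> {..?u}" using u by auto
    have "real ?u \<le> 2 * real a * real k" using uk by (metis of_nat_le_iff of_nat_mult of_nat_numeral)
    then have "1 / (2 * real k) \<le> real a / real ?u" using u k by (simp add: field_simps)
    then have "real m * \<bar>d1 - d0\<bar> / (4 * L\<^sup>2) * (1 / (2 * real k)) \<le>
       m * \<bar>d1 - d0\<bar> / (4 * L\<^sup>2) * (real a / real ?u)"
      by (intro mult_left_mono) auto
    then have "(real m * \<bar>d1 - d0\<bar> / (8 * L\<^sup>2 * k))\<^sup>2 / 8 \<le>
       (real m * \<bar>d1 - d0\<bar> / (4 * L\<^sup>2) * (real a / real ?u))\<^sup>2 / 8"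
      by (intro divide_right_mono power_mono) auto
    moreover have "affinity (attach_arcs m d0 (Suc ?u) m g) (attach_arcs m d1 (Suc ?u) m g) \<le>
        1 - (real m * \<bar>d1 - d0\<bar> / (4 * L\<^sup>2) * (real a / real ?u))\<^sup>2 / 8"
      using affinity_attach_arcs_le[OF val m d u(2) A] that by (simp add: B_def L_def)
    ultimately show ?thesis unfolding c_def by linarith
  qed
  have "affinity (graph_law m (\<lambda>_. d0) (Suc ?u)) (graph_law m \<delta> (Suc ?u)) \<le>
      (1 - c) * affinity ?p ?q + c * sqrt (measure ?p B)"
    unfolding graph_law_Suc[OF u(3)] \<delta>(2)[of "Suc ?u", simplified]
  proof (rule affinity_bind_le[where prev = "remove_vertex (Suc ?u)"])
    show "finite (set_pmf ?p)"
      using finite_graph_law[of m "\<lambda>_. d0"] d u by simp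
    show "finite (set_pmf (attach_arcs m d0 (Suc ?u) m g))" if "g \<in> set_pmf ?p" for g
      using finite_attach_arcs[OF graph_law_valid[OF _ u(3) that] u(3)] d by simp
    show "remove_vertex (Suc ?u) h = g"
      if "g \<in> set_pmf ?p" "h \<in> set_pmf (attach_arcs m d0 (Suc ?u) m g)" for g h
      using graph_law_recoverable[OF _ u(3) that] d by simp
    show "remove_vertex (Suc ?u) h = g"
      if "g \<in> set_pmf ?q" "h \<in> set_pmf (attach_arcs m d1 (Suc ?u) m g)" for g h
      using graph_law_recoverable[OF _ u(3) that] \<delta> by simp
  qed (use c good in auto)
  also have "\<dots> \<le> (1 - c) * ((1 - c) ^ j + sqrt (4 / real k)) + c * sqrt (4 / real k)"
    using c Suc.IH B by (intro add_mono mult_left_mono) auto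
  also have "\<dots> = (1 - c) ^ Suc j + sqrt (4 / real k)" by (simp add: algebra_simps)
  finally show ?case by simp
qed

section \<open>Bounded likelihood ratios\<close>

text \<open>
  Changing \<open>d\<close> into \<open>d'\<close> multiplies the weight \<open>degree g v + d\<close> of a vertex by at most the first
  factor, because degrees are at least \<open>m\<close>, and divides the total weight by at most the second,
  because the total weight for \<open>d'\<close> is at least \<open>(m + d') * t\<close>.
\<close>

definition ratio_bound :: "nat \<Rightarrow> real \<Rightarrow> real \<Rightarrow> real" where
  "ratio_bound m d d' = (1 + \<bar>d - d'\<bar> / (m + d)) * (1 + \<bar>d - d'\<bar> / (m + d'))"

lemma ratio_bound_ge_1:
  assumes "d > - real m" "d' > - real m"
  shows "1 \<le> ratio_bound m d d'"
proof -
  have "1 * 1 \<le> ratio_bound m d d'"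
    unfolding ratio_bound_def using assms by (intro mult_mono) auto
  then show ?thesis by simp
qed

lemma pmf_attach_pmf_le:
  assumes g: "pa_valid m t i g" and d: "d > - real m" "d' > - real m" and t: "2 \<le> t"
  shows "pmf (attach_pmf m d' t (Suc i) g) v \<le> ratio_bound m d d' * pmf (attach_pmf m d t (Suc i) g) v"
proof (cases "v < t")
  case True
  define \<epsilon> where "\<epsilon> = \<bar>d - d'\<bar>"
  let ?D = "\<lambda>x. 2 * real m * (real t - 1) + x * real t + real i"
  let ?k = "real (degree g v)"
  have deg: "real m \<le> ?k" using g True by (auto simp: pa_valid_def)
  have pos: "0 < ?D d" "0 < ?D d'" using attach_denominator_pos t d by auto
  have num: "?k + d' \<le> (1 + \<epsilon> / (m + d)) * (?k + d)"
  proof -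
    have "\<epsilon> = \<epsilon> / (m + d) * (m + d)" using d by simp
    also have "\<dots> \<le> \<epsilon> / (m + d) * (?k + d)"
      using deg d by (intro mult_left_mono) (auto simp: \<epsilon>_def)
    finally have "?k + d + \<epsilon> \<le> (1 + \<epsilon> / (m + d)) * (?k + d)" by (simp add: ring_distribs)
    moreover have "d' \<le> d + \<epsilon>" by (auto simp: \<epsilon>_def)
    ultimately show ?thesis by linarith
  qed
  have den: "?D d \<le> (1 + \<epsilon> / (m + d')) * ?D d'"
  proof -
    \<comment> \<open>\<open>t \<ge> 2\<close> is what makes \<open>2 * m * (t - 1) \<ge> m * t\<close>.\<close>
    have "0 \<le> m * (real t - 2) + real i" using t by (intro add_nonneg_nonneg mult_nonneg_nonneg) auto
    then have "(m + d') * t \<le> ?D d'" by (simp add: algebra_simps)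
    have "\<epsilon> * t = \<epsilon> / (m + d') * ((m + d') * t)" using d by simp
    also have "\<dots> \<le> \<epsilon> / (m + d') * ?D d'"
      using \<open>(m + d') * t \<le> ?D d'\<close> d by (intro mult_left_mono) (auto simp: \<epsilon>_def)
    finally have "?D d' + \<epsilon> * t \<le> (1 + \<epsilon> / (m + d')) * ?D d'" by (simp add: ring_distribs)
    moreover have "d * t \<le> (d' + \<epsilon>) * t" by (intro mult_right_mono) (auto simp: \<epsilon>_def)
    ultimately show ?thesis by (simp add: ring_distribs)
  qed
  have "(?k + d') * ?D d \<le> ((1 + \<epsilon> / (m + d)) * (?k + d)) * ((1 + \<epsilon> / (m + d')) * ?D d')"
    using num den pos deg d by (intro mult_mono) (auto simp: \<epsilon>_def)
  also have "\<dots> = ratio_bound m d d' * (?k + d) * ?D d'" by (simp add: ratio_bound_def \<epsilon>_def ac_simps)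
  finally have "(?k + d') / ?D d' \<le> ratio_bound m d d' * (?k + d) / ?D d"
    by (subst pos_divide_le_eq[OF pos(2)], subst times_divide_eq_left, subst pos_le_divide_eq[OF pos(1)])
  then show ?thesis using pmf_attach_pmf[OF g _ t] d True by simp
next
  case False
  then show ?thesis using pmf_attach_pmf[OF g _ t] d by simp
qed

lemma pmf_map_le:
  assumes "finite (set_pmf p)" "0 \<le> c" "\<And>x. pmf q x \<le> c * pmf p x"
  shows "pmf (map_pmf f q) y \<le> c * pmf (map_pmf f p) y"
  unfolding pmf_map using assms by (intro prob_le_of_pmf_le)

lemma pmf_attach_arcs_le:
  assumes g: "pa_valid m t m g" and t: "1 \<le> t" and d: "d > - real m" "d' > - real m"
  shows "pmf (attach_arcs m d' (Suc t) i g) h \<le>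
       ratio_bound m d d' ^ i * pmf (attach_arcs m d (Suc t) i g) h"
proof (induction i arbitrary: h)
  case (Suc i)
  have R: "0 \<le> ratio_bound m d d'" using ratio_bound_ge_1[OF d] by simp
  have t2: "2 \<le> Suc t" using t by simp
  have "pmf (attach_arcs m d' (Suc t) (Suc i) g) h \<le>
    ratio_bound m d d' ^ i * ratio_bound m d d' * pmf (attach_arcs m d (Suc t) (Suc i) g) h"
    unfolding attach_arcs.simps
  proof (rule pmf_bind_le)
    fix h' y assume h': "h' \<in> set_pmf (attach_arcs m d' (Suc t) i g)"
    note val = attach_arcs_valid[OF g t d(2) h']
    show "pmf (map_pmf (\<lambda>v. add_arc (Suc t) v h') (attach_pmf m d' (Suc t) (Suc i) h')) y \<le>
      ratio_bound m d d' * pmf (map_pmf (\<lambda>v. add_arc (Suc t) v h') (attach_pmf m d (Suc t) (Suc i) h')) y"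
      using finite_subset[OF set_attach_pmf[OF val d(1) t2]]
      by (intro pmf_map_le pmf_attach_pmf_le[OF val d t2] R) auto
  qed (use finite_attach_arcs[OF g t d(1)] Suc.IH R in auto)
  then show ?case by (simp add: mult.commute)
qed simp

lemma graph_law_cong:
  assumes "1 \<le> n" "\<And>t. t \<le> n \<Longrightarrow> \<delta> t = \<delta>' t"
  shows "graph_law m \<delta> n = graph_law m \<delta>' n"
  using assms
proof (induction n rule: nat_induct_at_least)
  case base
  then show ?case by (simp add: graph_law_def)
next
  case (Suc n)
  then show ?case by (simp add: graph_law_Suc)
qed

text \<open>
  Besides the uniform bound behind contiguity, this yields the absolute continuity of
  \<open>Q\<^sub>1\<close> with respect to \<open>Q\<^sub>0\<close>, on which the description of the test by a Radon-Nikodym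
  derivative rests.
\<close>

lemma pmf_graph_law_le:
  assumes d: "d0 > - real m" "d1 > - real m" and \<tau>: "1 \<le> \<tau>"
  defines "\<delta> \<equiv> \<lambda>t. if t \<le> \<tau> then d0 else d1"
  shows "pmf (graph_law m \<delta> (\<tau> + j)) g \<le>
       (ratio_bound m d0 d1 ^ m) ^ j * pmf (graph_law m (\<lambda>_. d0) (\<tau> + j)) g"
proof (induction j arbitrary: g)
  case 0
  have "graph_law m \<delta> \<tau> = graph_law m (\<lambda>_. d0) \<tau>"
    by (rule graph_law_cong[OF \<tau>]) (simp add: \<delta>_def)
  then show ?case by simp
next
  case (Suc j)
  have R: "0 \<le> ratio_bound m d0 d1" using ratio_bound_ge_1[OF d] by simp
  have \<delta>: "\<delta> t > - real m" for t using d by (simp add: \<delta>_def)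
  have n: "1 \<le> \<tau> + j" using \<tau> by simp
  have [simp]: "\<delta> (Suc (\<tau> + j)) = d1" by (simp add: \<delta>_def)
  have "pmf (graph_law m \<delta> (Suc (\<tau> + j))) g \<le>
    (ratio_bound m d0 d1 ^ m) ^ j * ratio_bound m d0 d1 ^ m * pmf (graph_law m (\<lambda>_. d0) (Suc (\<tau> + j))) g"
    unfolding graph_law_Suc[OF n]
  proof (rule pmf_bind_le)
    fix g h assume "g \<in> set_pmf (graph_law m \<delta> (\<tau> + j))"
    then show "pmf (attach_arcs m (\<delta> (Suc (\<tau> + j))) (Suc (\<tau> + j)) m g) h \<le>
      ratio_bound m d0 d1 ^ m * pmf (attach_arcs m d0 (Suc (\<tau> + j)) m g) h"
      using pmf_attach_arcs_le[OF graph_law_valid[OF \<delta> n] n d] by simp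
  qed (use finite_graph_law[of m "\<lambda>_. d0", OF _ n] d Suc.IH R in auto)
  then show ?case by (simp add: mult.commute)
qed

section \<open>Detection and contiguity\<close>

theorem theorem3p6:
  fixes m :: nat and \<delta>0 \<delta>1 :: real and \<tau> :: "nat \<Rightarrow> nat"
  assumes "1 \<le> m"
    and "\<delta>0 > - real m" and "\<delta>1 > - real m" and "\<delta>0 \<noteq> \<delta>1"
    and "\<And>n. 1 \<le> n \<Longrightarrow> 1 \<le> \<tau> n \<and> \<tau> n \<le> n"
  shows
    "(filterlim \<tau> at_top sequentially \<and> filterlim (\<lambda>n. n - \<tau> n) at_top sequentially \<longrightarrow>
       (\<lambda>n. let T = (\<lambda>G. lr_test (measure_pmf (Q0 m \<delta>0 n)) (measure_pmf (Q1 m \<delta>0 \<delta>1 \<tau> n))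
                           (graph_at m n G))
            in measure_pmf.expectation (P0 m \<delta>0 n) T
               + measure_pmf.expectation (P1 m \<delta>0 \<delta>1 \<tau> n) (\<lambda>G. 1 - T G)) \<longlonglongrightarrow> 0)
     \<and> (limsup (\<lambda>n. ereal (real (n - \<tau> n))) < \<infinity> \<longrightarrow>
       contiguous (\<lambda>n. measure_pmf (Q1 m \<delta>0 \<delta>1 \<tau> n)) (\<lambda>n. measure_pmf (Q0 m \<delta>0 n)))"
proof (intro conjI impI)
  define \<delta> where "\<delta> n t = (if t \<le> \<tau> n then \<delta>0 else \<delta>1)" for n t
  define R where "R = ratio_bound m \<delta>0 \<delta>1 ^ m"
  have \<delta>: "\<delta> n t > - real m" for n t using assms by (simp add: \<delta>_def)
  have Q0: "Q0 m \<delta>0 n = graph_law m (\<lambda>_. \<delta>0) n" for n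
    by (simp add: Q0_def P0_def graph_law_def)
  have Q1: "Q1 m \<delta>0 \<delta>1 \<tau> n = graph_law m (\<delta> n) n" for n
    by (simp add: Q1_def P1_def graph_law_def \<delta>_def[abs_def])
  have R: "1 \<le> R"
    using ratio_bound_ge_1 assms by (simp add: R_def one_le_power)
  have fin: "finite (set_pmf (Q0 m \<delta>0 n))" if "1 \<le> n" for n
    using finite_graph_law[of m "\<lambda>_. \<delta>0"] that assms by (simp add: Q0)
  have dom: "pmf (Q1 m \<delta>0 \<delta>1 \<tau> n) g \<le> R ^ (n - \<tau> n) * pmf (Q0 m \<delta>0 n) g" if n: "1 \<le> n" for n g
    using pmf_graph_law_le[OF assms(2,3), of "\<tau> n" "n - \<tau> n" g] assms(5)[OF n]
    by (simp add: Q0 Q1 \<delta>_def[abs_def] R_def)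
  {
    assume lim: "filterlim \<tau> at_top sequentially \<and> filterlim (\<lambda>n. n - \<tau> n) at_top sequentially"
    define err where "err n = measure_pmf.expectation (Q0 m \<delta>0 n) (lr_test (Q0 m \<delta>0 n) (Q1 m \<delta>0 \<delta>1 \<tau> n)) +
      measure_pmf.expectation (Q1 m \<delta>0 \<delta>1 \<tau> n) (\<lambda>g. 1 - lr_test (Q0 m \<delta>0 n) (Q1 m \<delta>0 \<delta>1 \<tau> n) g)" for n
    have err0: "0 \<le> err n" for n
      unfolding err_def by (intro add_nonneg_nonneg integral_nonneg) (auto simp: lr_test_def)
    have err_le: "err n \<le> affinity (Q0 m \<delta>0 n) (Q1 m \<delta>0 \<delta>1 \<tau> n)" if "1 \<le> n" for n
      unfolding err_def
      by (rule lr_test_error_le_affinity[OF fin[OF that] set_pmf_subset_of_pmf_le[OF dom[OF that]]])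
    have "err \<longlonglongrightarrow> 0"
    proof (rule tendstoI)
      fix \<epsilon> :: real assume "0 < \<epsilon>"
      \<comment> \<open>The constant 16 makes \<open>\<surd>(4 / k)\<close> smaller than \<open>\<epsilon> / 2\<close>.\<close>
      obtain k :: nat where k: "max 2 (16 / \<epsilon>\<^sup>2) < k" using reals_Archimedean2 by blast
      then have k2: "2 \<le> k" by simp
      have "4 / real k < (\<epsilon> / 2)\<^sup>2"
        using k \<open>0 < \<epsilon>\<close> by (simp add: power_divide pos_divide_less_eq mult.commute)
      then have sqrt: "sqrt (4 / real k) < \<epsilon> / 2"
        using \<open>0 < \<epsilon>\<close> by (intro real_less_lsqrt) auto
      define c where "c = min 1 ((real m * \<bar>\<delta>1 - \<delta>0\<bar> /
        (8 * (2 * real m + 2 * \<bar>\<delta>0\<bar> + 2 * \<bar>\<delta>1\<bar>)\<^sup>2 * k))\<^sup>2 / 8)"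
      have "0 < 2 * real m + 2 * \<bar>\<delta>0\<bar> + 2 * \<bar>\<delta>1\<bar>" using assms(1) by simp
      then have c: "0 < c" "c \<le> 1" using assms(1,4) k2 by (auto simp: c_def)
      have "(\<lambda>j. (1 - c) ^ j) \<longlonglongrightarrow> 0" using c by (intro LIMSEQ_power_zero) auto
      then have "(\<lambda>n. (1 - c) ^ (n - \<tau> n)) \<longlonglongrightarrow> 0"
        by (rule filterlim_compose[OF _ conjunct2[OF lim]])
      then have "\<forall>\<^sub>F n in sequentially. (1 - c) ^ (n - \<tau> n) < \<epsilon> / 2"
        by (rule order_tendstoD) (use \<open>0 < \<epsilon>\<close> in auto)
      moreover have "\<forall>\<^sub>F n in sequentially. max 6 k \<le> \<tau> n"
        by (rule filterlim_at_top[THEN iffD1, THEN spec, OF conjunct1[OF lim]])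
      ultimately show "\<forall>\<^sub>F n in sequentially. dist (err n) 0 < \<epsilon>"
        using eventually_ge_at_top[of 1]
      proof eventually_elim
        case (elim n)
        have "err n \<le> affinity (graph_law m (\<lambda>_. \<delta>0) n) (graph_law m (\<delta> n) n)"
          using err_le[OF elim(3)] by (simp add: Q0 Q1)
        also have "\<dots> \<le> (1 - c) ^ (n - \<tau> n) + sqrt (4 / real k)"
          using affinity_graph_law_le[OF assms(1-3) k2, of "\<tau> n" "\<delta> n" "n - \<tau> n"] \<delta>[of n] assms(5)[OF elim(3)] elim(2)
          by (simp add: c_def \<delta>_def)
        finally show ?case using elim(1) sqrt err0[of n] by simp
      qed
    qed
    then show "(\<lambda>n. let T = (\<lambda>G. lr_test (measure_pmf (Q0 m \<delta>0 n)) (measure_pmf (Q1 m \<delta>0 \<delta>1 \<tau> n))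
                           (graph_at m n G))
            in measure_pmf.expectation (P0 m \<delta>0 n) T
               + measure_pmf.expectation (P1 m \<delta>0 \<delta>1 \<tau> n) (\<lambda>G. 1 - T G)) \<longlonglongrightarrow> 0"
      by (simp add: err_def[abs_def] Let_def Q0_def Q1_def)
  next
    assume "limsup (\<lambda>n. ereal (real (n - \<tau> n))) < \<infinity>"
    then obtain K where "limsup (\<lambda>n. ereal (real (n - \<tau> n))) < ereal K"
      using less_PInf_Ex_of_nat by fastforce
    then have K: "\<forall>\<^sub>F n in sequentially. real (n - \<tau> n) < K"
      using Limsup_lessD by fastforce
    show "contiguous (\<lambda>n. measure_pmf (Q1 m \<delta>0 \<delta>1 \<tau> n)) (\<lambda>n. measure_pmf (Q0 m \<delta>0 n))"
      unfolding contiguous_def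
    proof (intro allI impI)
      fix E :: "nat \<Rightarrow> lgraph set"
      assume E: "(\<lambda>n. measure (Q0 m \<delta>0 n) (E n)) \<longlonglongrightarrow> 0"
      have "\<forall>\<^sub>F n in sequentially. measure (Q1 m \<delta>0 \<delta>1 \<tau> n) (E n) \<le> R ^ nat \<lceil>K\<rceil> * measure (Q0 m \<delta>0 n) (E n)"
        using K eventually_ge_at_top[of 1]
      proof eventually_elim
        case (elim n)
        have "n - \<tau> n \<le> nat \<lceil>K\<rceil>" using elim(1) by linarith
        then have "R ^ (n - \<tau> n) \<le> R ^ nat \<lceil>K\<rceil>" using R by (rule power_increasing)
        moreover have "measure (Q1 m \<delta>0 \<delta>1 \<tau> n) (E n) \<le> R ^ (n - \<tau> n) * measure (Q0 m \<delta>0 n) (E n)"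
          by (rule prob_le_of_pmf_le[OF fin dom]) (use elim in auto)
        ultimately show ?case by (meson measure_nonneg mult_right_mono order_trans)
      qed
      moreover have "(\<lambda>n. R ^ nat \<lceil>K\<rceil> * measure (Q0 m \<delta>0 n) (E n)) \<longlonglongrightarrow> 0"
        using tendsto_mult_left[OF E, of "R ^ nat \<lceil>K\<rceil>"] by simp
      ultimately show "(\<lambda>n. measure (Q1 m \<delta>0 \<delta>1 \<tau> n) (E n)) \<longlonglongrightarrow> 0"
        by (rule tendsto_sandwich[of "\<lambda>_. 0", OF always_eventually[OF allI[OF measure_nonneg]] _ tendsto_const])
    qed
  }
qed

end
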